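(* Let $m\le n$, let $Q\in\mathbb{R}^{n\times n}$ be symmetric positive semidefinite, let $A\in\mathbb{R}^{m\times n}$ have full rank, and let $\Theta^{(1)}\in\mathbb{R}^{n\times n}$ be diagonal positive definite. Let $G=\mathrm{diag}(Q+\Theta^{(1)})$ and $S=AG^{-1}A^T$. Let $J\in\mathbb{R}^{n\times n}$ be diagonal positive definite and let $S_{upd}=AJ^{-1}A^T$. Set $$\mathcal{A}=\begin{bmatrix} Q+\Theta^{(1)} & A^T\\ A & 0\end{bmatrix},\qquad \mathcal{P}_{upd}=\begin{bmatrix} I_n & 0\\ AG^{-1} & I_m\end{bmatrix}\begin{bmatrix} G & 0\\ 0 & -S_{upd}\end{bmatrix}\begin{bmatrix} I_n & G^{-1}A^T\\ 0 & I_m\end{bmatrix},$$ and let $$\gamma_1(J)=\min_{1\le i\le n}\frac{J_{ii}}{G_{ii}},\qquad \gamma_n(J)=\max_{1\le i\le n}\frac{J_{ii}}{G_{ii}}.$$ Let $X=G^{-\frac12}(Q+\Theta^{(1)})G^{-\frac12}$ and suppose that $2I_n-X$ is positive definite. Define $$\bar\lambda=\lambda_{\max}(S_{upd}^{-1}S)\,(2-\lambda_{\min}(X)),\qquad \underline{\lambda}=\lambda_{\min}(S_{upd}^{-1}S)\,(2-\lambda_{\max}(X)).$$ Let $\lambda$ be an eigenvalue of $\mathcal{P}_{upd}^{-1}\mathcal{A}$ with corresponding eigenvector $[x^T,y^T]^T$ (with $x$ of length $n$ and $y$ of length $m$). If $\lambda$ has nonzero imaginary part, then $$\tfrac12\left(\lambda_{\min}(X)+\underline{\lambda}\right)\le\mathcal{R}(\lambda)\le\tfrac12\left(\lambda_{\max}(X)+\bar\lambda\right);$$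 otherwise $$\min\{\lambda_{\min}(X),\,\underline{\lambda}\}\le\lambda\le\max\{\lambda_{\max}(X),\,\bar\lambda\}\quad\text{for } y\neq 0,$$ $$\lambda_{\min}(X)\le\lambda\le\lambda_{\max}(X)\quad\text{for } y=0;$$ and here $$\bar\lambda\le\gamma_n(J)\,(2-\lambda_{\min}(X)),\qquad \underline{\lambda}\ge\gamma_1(J)\,(2-\lambda_{\max}(X)).$$ Furthermore, $$|\mathcal{I}(\lambda)|\le\sqrt{\gamma_n(J)}\;\|I_n-X\|.$$
   Context: $\mathrm{diag}(M)$ denotes the diagonal matrix with the same diagonal entries as $M$. $I_r$ is the $r\times r$ identity matrix. $\|\cdot\|$ is the vector or matrix 2-norm. $\lambda_{\min}(\cdot)$ and $\lambda_{\max}(\cdot)$ denote the minimum and maximum eigenvalues of a matrix with real eigenvalues (symmetric matrices, and products such as $S_{upd}^{-1}S$, which are similar to symmetric matrices). $\mathcal{R}(\alpha)$ and $\mathcal{I}(\alpha)$ denote the real and imaginary parts of a complex number $\alpha$. Eigenvalues and eigenvectors of $\mathcal{P}_{upd}^{-1}\mathcal{A}$ may be complex. *)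

theory Defs
  imports "HOL-Analysis.Analysis"
begin

definition symmetric_matrix :: "real^'k^'k \<Rightarrow> bool" where
  "symmetric_matrix M \<longleftrightarrow> transpose M = M"

definition pos_semidefinite :: "real^'k^'k \<Rightarrow> bool" where
  "pos_semidefinite M \<longleftrightarrow> symmetric_matrix M \<and> (\<forall>v. 0 \<le> v \<bullet> (M *v v))"

definition pos_definite :: "real^'k^'k \<Rightarrow> bool" where
  "pos_definite M \<longleftrightarrow> symmetric_matrix M \<and> (\<forall>v. v \<noteq> 0 \<longrightarrow> 0 < v \<bullet> (M *v v))"

definition diagonal_matrix :: "'a::zero^'k^'k \<Rightarrow> bool" where
  "diagonal_matrix M \<longleftrightarrow> (\<forall>i j. i \<noteq> j \<longrightarrow> M $ i $ j = 0)"

definition diag_part :: "'a::zero^'k^'k \<Rightarrow> 'a^'k^'k" where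
  "diag_part M = (\<chi> i j. if i = j then M $ i $ i else 0)"

text \<open>Real power of a diagonal matrix with positive diagonal; off-diagonal entries of the
  argument are ignored.\<close>

definition diag_powr :: "real^'k^'k \<Rightarrow> real \<Rightarrow> real^'k^'k" where
  "diag_powr D p = (\<chi> i j. if i = j then (D $ i $ i) powr p else 0)"

text \<open>Rows of the block matrix are indexed by \<open>'p + 'q\<close> and columns by \<open>'r + 's\<close>.\<close>

definition block_matrix ::
  "'a^'r^'p \<Rightarrow> 'a^'s^'p \<Rightarrow> 'a^'r^'q \<Rightarrow> 'a^'s^'q \<Rightarrow> 'a^('r::finite + 's::finite)^('p::finite + 'q::finite)" where
  "block_matrix A B C D = (\<chi> i j.
     case i of
       Inl a \<Rightarrow> (case j of Inl c \<Rightarrow> A $ a $ c | Inr d \<Rightarrow> B $ a $ d)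
     | Inr b \<Rightarrow> (case j of Inl c \<Rightarrow> C $ b $ c | Inr d \<Rightarrow> D $ b $ d))"

definition block_vector :: "'a^'p \<Rightarrow> 'a^'q \<Rightarrow> 'a^('p::finite + 'q::finite)" where
  "block_vector x y = (\<chi> i. case i of Inl a \<Rightarrow> x $ a | Inr b \<Rightarrow> y $ b)"

definition eigenvector :: "'a::field^'k^'k \<Rightarrow> 'a^'k \<Rightarrow> 'a \<Rightarrow> bool" where
  "eigenvector M v l \<longleftrightarrow> v \<noteq> 0 \<and> M *v v = l *s v"

definition eigenvalue :: "'a::field^'k^'k \<Rightarrow> 'a \<Rightarrow> bool" where
  "eigenvalue M l \<longleftrightarrow> (\<exists>v. eigenvector M v l)"

text \<open>The next two are meant for matrices all of whose complex eigenvalues are real; for other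
  matrices non-real eigenvalues are ignored.\<close>

definition lambda_min :: "real^'k^'k \<Rightarrow> real" where
  "lambda_min M = Min {l. eigenvalue M l}"

definition lambda_max :: "real^'k^'k \<Rightarrow> real" where
  "lambda_max M = Max {l. eigenvalue M l}"

text \<open>The \<open>norm\<close> of the library on \<open>real^'k^'k\<close> is the Frobenius norm, so the 2-norm is the operator
  norm induced by the Euclidean norm.\<close>

definition matrix_norm2 :: "real^'r^'p \<Rightarrow> real" where
  "matrix_norm2 M = onorm (\<lambda>v. M *v v)"

abbreviation complex_matrix :: "real^'r^'p \<Rightarrow> complex^'r^'p" where
  "complex_matrix \<equiv> map_matrix complex_of_real"

end

theory Submission
  imports Defs
begin

text \<open>
  Put \<open>w = G\<^sup>1\<^sup>/\<^sup>2 x + G\<^sup>-\<^sup>1\<^sup>/\<^sup>2 A\<^sup>T y\<close>, \<open>z = G\<^sup>-\<^sup>1\<^sup>/\<^sup>2 A\<^sup>T y\<close> and \<open>B = A G\<^sup>-\<^sup>1\<^sup>/\<^sup>2\<close>. The eigenvalue equation becomes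
  \<open>X w + (I - X) z = \<lambda> w\<close> and \<open>B ((2 I - X) z - (I - X) w) = \<lambda> S\<^sub>u\<^sub>p\<^sub>d y\<close>, whose off-diagonal coupling is
  skew-adjoint. Taking inner products with \<open>w\<close> and \<open>y\<close>, and writing \<open>a = w\<^sup>* w\<close>, \<open>b = y\<^sup>* S\<^sub>u\<^sub>p\<^sub>d y\<close>,
  \<open>p = w\<^sup>* X w\<close>, \<open>q = z\<^sup>* (2 I - X) z\<close>, \<open>c = w\<^sup>* (I - X) z\<close>, one gets
  \<open>p + c = \<lambda> a\<close> and \<open>q - cnj c = \<lambda> b\<close>. Hence \<open>Re \<lambda> (a + b) = p + q\<close> is a weighted average of Rayleigh
  quotients, and \<open>Im c = Im \<lambda> a = Im \<lambda> b\<close> forces \<open>a = b\<close> for nonreal \<open>\<lambda>\<close>; then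
  \<open>\<bar>Im \<lambda>\<bar> a \<le> \<bar>c\<bar> \<le> \<parallel>I - X\<parallel> \<parallel>w\<parallel> \<parallel>z\<parallel>\<close> with \<open>\<parallel>z\<parallel>\<^sup>2 = y\<^sup>* S y \<le> \<gamma>\<^sub>n b\<close>.
\<close>

subsection \<open>Rayleigh quotients of symmetric-definite pencils\<close>

lemma dot_matrix_vector_transpose:
  fixes M :: "real^'r^'p"
  shows "u \<bullet> (M *v v) = (transpose M *v u) \<bullet> v"
  by (simp add: dot_lmul_matrix)

lemma symmetric_matrix_dot:
  "symmetric_matrix M \<Longrightarrow> u \<bullet> (M *v v) = (M *v u) \<bullet> v"
  by (simp add: dot_matrix_vector_transpose symmetric_matrix_def)

lemma uminus_matrix_vector: "(- M) *v v = - (M *v v)" for M :: "'a::ring_1^'r^'p"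
  using matrix_vector_mult_diff_rdistrib[of 0 M v] by simp

lemma symmetric_matrix_diff:
  "symmetric_matrix M \<Longrightarrow> symmetric_matrix N \<Longrightarrow> symmetric_matrix (M - N)"
  by (simp add: symmetric_matrix_def transpose_def vec_eq_iff)

lemma symmetric_matrix_uminus: "symmetric_matrix M \<Longrightarrow> symmetric_matrix (- M)"
  by (simp add: symmetric_matrix_def transpose_def vec_eq_iff)

lemma symmetric_matrix_scaleR: "symmetric_matrix M \<Longrightarrow> symmetric_matrix (c *\<^sub>R M)"
  by (simp add: symmetric_matrix_def transpose_def vec_eq_iff)

lemma symmetric_matrix_mat [simp]: "symmetric_matrix (mat c)"
  by (simp add: symmetric_matrix_def)

lemma pos_definite_mat_1 [simp]: "pos_definite (mat 1)"
  by (simp add: pos_definite_def)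

lemma symmetric_matrix_congruence:
  "symmetric_matrix M \<Longrightarrow> symmetric_matrix (B ** M ** transpose B)"
  by (simp add: symmetric_matrix_def matrix_transpose_mul matrix_mul_assoc)

lemma matrix_inv_unique:
  fixes M :: "'a::semiring_1^'k^'k"
  assumes "M ** N = mat 1" "N ** M = mat 1"
  shows "matrix_inv M = N"
proof -
  have "M ** matrix_inv M = mat 1 \<and> matrix_inv M ** M = mat 1"
    unfolding matrix_inv_def by (rule someI[of _ N]) (simp add: assms)
  then have "matrix_inv M = (N ** M) ** matrix_inv M" "M ** matrix_inv M = mat 1"
    by (simp_all add: assms)
  then show ?thesis
    by (simp flip: matrix_mul_assoc)
qed

lemma matrix_inv_mult:
  assumes "invertible M"
  shows "M ** matrix_inv M = mat 1" "matrix_inv M ** M = mat 1"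
  using someI_ex[OF assms[unfolded invertible_def]] by (auto simp: matrix_inv_def)

lemma matrix_inv_vector_eq_iff:
  assumes "invertible M"
  shows "matrix_inv M *v u = v \<longleftrightarrow> u = M *v v"
  using matrix_inv_mult[OF assms] by (metis matrix_vector_mul_assoc matrix_vector_mul_lid)

lemma invertible_if_kernel_trivial:
  fixes M :: "real^'k^'k"
  assumes "\<And>v. M *v v = 0 \<Longrightarrow> v = 0"
  shows "invertible M"
  using assms by (auto simp: invertible_left_inverse matrix_left_invertible_ker)

lemma pos_definite_invertible: "pos_definite M \<Longrightarrow> invertible M"
  by (rule invertible_if_kernel_trivial) (force simp: pos_definite_def)

lemma pos_definite_diag_pos: "pos_definite M \<Longrightarrow> 0 < M $ i $ i"
  unfolding pos_definite_def
  by (auto dest!: spec[of _ "axis i 1"] simp: matrix_vector_mult_basis inner_axis' column_def axis_eq_0_iff)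

text \<open>A zero of a nonnegative quadratic form is a minimum of it. If \<open>K v\<close> were
  nonzero, a short step from \<open>v\<close> against \<open>K v\<close> would make the form
  negative.\<close>

lemma pos_semidefinite_kernel:
  assumes K: "pos_semidefinite K" and v: "v \<bullet> (K *v v) = 0"
  shows "K *v v = 0"
proof (rule ccontr)
  assume "K *v v \<noteq> 0"
  define h where "h = K *v v"
  define c where "c = h \<bullet> (K *v h)"
  have n: "h \<bullet> h > 0" using \<open>K *v v \<noteq> 0\<close> by (simp add: h_def)
  have c0: "c \<ge> 0" using K by (simp add: c_def pos_semidefinite_def)
  have vh: "v \<bullet> (K *v h) = h \<bullet> h"
    using K by (simp add: pos_semidefinite_def symmetric_matrix_dot h_def)
  \<comment> \<open>The form at \<open>v + t h\<close> is
    \<open>2 t (h \<bullet> h) + t\<^sup>2 c\<close>. Its minimiser divides by \<open>c\<close>,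
    which may be 0; dividing by \<open>c + 1\<close> is safe and still gives a negative
    value.\<close>
  define t where "t = - (h \<bullet> h) / (c + 1)"
  have "0 \<le> (v + t *\<^sub>R h) \<bullet> (K *v (v + t *\<^sub>R h))"
    using K by (simp add: pos_semidefinite_def)
  also have "\<dots> = 2 * t * (h \<bullet> h) + t\<^sup>2 * c"
    using v vh by (simp add: matrix_vector_right_distrib matrix_vector_mult_scaleR inner_add_left
        inner_add_right c_def power2_eq_square algebra_simps flip: h_def)
  also have "\<dots> = - ((h \<bullet> h)\<^sup>2 * (c + 2) / (c + 1)\<^sup>2)"
    using c0 unfolding t_def by (simp add: divide_simps power2_eq_square) algebra
  also have "\<dots> < 0" using n c0 by simp
  finally show False by simp
qed

text \<open>The product \<open>matrix_inv N ** M\<close> is in general not symmetric even for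
  symmetric factors, so its eigenvalues are studied through the pencil \<open>M v = l N v\<close>,
  where symmetry survives.\<close>

lemma eigenvalue_matrix_inv_mult_iff:
  assumes "invertible N"
  shows "eigenvalue (matrix_inv N ** M) l \<longleftrightarrow> (\<exists>v. v \<noteq> 0 \<and> M *v v = l *s (N *v v))"
  by (simp add: eigenvalue_def eigenvector_def matrix_inv_vector_eq_iff[OF assms]
      vec.scale flip: matrix_vector_mul_assoc)

text \<open>Eigenvectors of distinct eigenvalues are orthogonal for the inner product given by
  \<open>N\<close>, hence independent. Finiteness is what gives \<open>Min\<close> and
  \<open>Max\<close> in \<open>lambda_min\<close> and \<open>lambda_max\<close> their
  meaning.\<close>

lemma finite_generalized_eigenvalues:
  fixes N M :: "real^'k^'k"
  assumes N: "pos_definite N" and M: "symmetric_matrix M"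
  shows "finite {l. eigenvalue (matrix_inv N ** M) l}" (is "finite ?E")
proof -
  have inv: "invertible N" by (rule pos_definite_invertible[OF N])
  have "\<forall>l\<in>?E. \<exists>v. v \<noteq> 0 \<and> M *v v = l *\<^sub>R (N *v v)"
    by (simp add: eigenvalue_matrix_inv_mult_iff[OF inv] scalar_mult_eq_scaleR)
  then obtain f where f: "\<And>l. l \<in> ?E \<Longrightarrow> f l \<noteq> 0 \<and> M *v f l = l *\<^sub>R (N *v f l)"
    by (metis (no_types, lifting))
  have orth: "f k \<bullet> (N *v f l) = 0" if "k \<in> ?E" "l \<in> ?E" "k \<noteq> l" for k l
  proof -
    have "l * (f k \<bullet> (N *v f l)) = f k \<bullet> (M *v f l)" using f that by simp
    also have "\<dots> = (M *v f k) \<bullet> f l" by (rule symmetric_matrix_dot[OF M])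
    also have "\<dots> = k * ((N *v f k) \<bullet> f l)" using f that by simp
    also have "\<dots> = k * (f k \<bullet> (N *v f l))"
      using N by (simp add: symmetric_matrix_dot pos_definite_def)
    finally show ?thesis using that by simp
  qed
  have pos: "f l \<bullet> (N *v f l) > 0" if "l \<in> ?E" for l
    using N f that by (simp add: pos_definite_def)
  have inj: "inj_on f ?E"
    by (rule inj_onI) (metis orth pos less_irrefl)
  have "independent (f ` ?E)"
    unfolding independent_explicit_module
  proof (intro allI impI)
    fix T u v assume T: "finite T" "T \<subseteq> f ` ?E" "(\<Sum>v\<in>T. u v *\<^sub>R v) = 0" "v \<in> T"
    \<comment> \<open>Pairing the vanishing combination with \<open>N v\<close> leaves only the term
      of \<open>v\<close>, by orthogonality.\<close>
    have "0 = (\<Sum>w\<in>T. u w *\<^sub>R w) \<bullet> (N *v v)" using T by simp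
    also have "\<dots> = (\<Sum>w\<in>T. u w * (w \<bullet> (N *v v)))" by (simp add: inner_sum_left)
    also have "\<dots> = (\<Sum>w\<in>T. if w = v then u v * (v \<bullet> (N *v v)) else 0)"
    proof (intro sum.cong refl)
      fix w assume "w \<in> T"
      then obtain k l where "w = f k" "v = f l" "k \<in> ?E" "l \<in> ?E"
        using T(2,4) by blast
      then show "u w * (w \<bullet> (N *v v)) = (if w = v then u v * (v \<bullet> (N *v v)) else 0)"
        using orth[of k l] by auto
    qed
    also have "\<dots> = u v * (v \<bullet> (N *v v))" using T by simp
    finally show "u v = 0" using T(2,4) pos by force
  qed
  then show ?thesis
    using independent_bound inj finite_imageD by blast
qed

text \<open>By compactness the quotient \<open>f\<close> has a maximum \<open>l\<close> on the unit
  sphere, and by homogeneity it bounds \<open>f\<close> at all nonzero vectors. Then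
  \<open>l N - M\<close> is positive semidefinite with form 0 at the maximiser, which therefore lies
  in its kernel and is an eigenvector.\<close>

lemma generalized_eigenvalue_ge_quotient:
  fixes N M :: "real^'k^'k"
  assumes N: "pos_definite N" and M: "symmetric_matrix M"
  shows "\<exists>l. eigenvalue (matrix_inv N ** M) l \<and> (\<forall>v. v \<bullet> (M *v v) \<le> l * (v \<bullet> (N *v v)))"
proof -
  define f where "f v = (v \<bullet> (M *v v)) / (v \<bullet> (N *v v))" for v
  have Npos: "v \<bullet> (N *v v) > 0" if "v \<noteq> 0" for v
    using N that by (simp add: pos_definite_def)
  have lin: "continuous_on S ((*v) K)" for S and K :: "real^'k^'k"
    by (rule linear_continuous_on) (rule matrix_vector_mul_bounded_linear)
  have "continuous_on (sphere 0 1) f"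
    unfolding f_def using Npos
    by (intro continuous_intros lin) (metis less_irrefl norm_zero zero_neq_one mem_sphere_0)
  moreover have "sphere 0 1 \<noteq> ({} :: (real^'k) set)" by simp
  ultimately obtain v0 where v0: "v0 \<in> sphere 0 1" "\<And>v. v \<in> sphere 0 1 \<Longrightarrow> f v \<le> f v0"
    using continuous_attains_sup[of "sphere 0 1" f] compact_sphere by blast
  define l where "l = f v0"
  have v0n: "v0 \<noteq> 0" using v0 by auto
  have le: "v \<bullet> (M *v v) \<le> l * (v \<bullet> (N *v v))" for v
  proof (cases "v = 0")
    case False
    have "f v = f (v /\<^sub>R norm v)" using False
      by (simp add: f_def matrix_vector_mult_scaleR)
    also have "\<dots> \<le> l" using v0 False by (simp add: l_def)
    finally show ?thesis using Npos[OF False] by (simp add: f_def divide_simps)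
  qed simp
  have form: "v \<bullet> ((l *\<^sub>R N - M) *v v) = l * (v \<bullet> (N *v v)) - v \<bullet> (M *v v)" for v
    by (simp add: matrix_vector_mult_diff_rdistrib inner_diff_right flip: scaleR_matrix_vector_assoc)
  have "pos_semidefinite (l *\<^sub>R N - M)"
    using le N M by (simp add: pos_semidefinite_def form symmetric_matrix_diff
        symmetric_matrix_scaleR pos_definite_def)
  moreover have "v0 \<bullet> ((l *\<^sub>R N - M) *v v0) = 0"
    unfolding form using Npos[OF v0n] by (simp add: l_def f_def)
  ultimately have "(l *\<^sub>R N - M) *v v0 = 0" by (rule pos_semidefinite_kernel)
  then have "M *v v0 = l *s (N *v v0)"
    by (simp add: matrix_vector_mult_diff_rdistrib scalar_mult_eq_scaleR flip: scaleR_matrix_vector_assoc)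
  then show ?thesis
    using le v0n eigenvalue_matrix_inv_mult_iff[OF pos_definite_invertible[OF N]] by blast
qed

text \<open>The upper bound for \<open>- M\<close>, with the sign of the eigenvalue
  reversed.\<close>

lemma generalized_eigenvalue_le_quotient:
  fixes N M :: "real^'k^'k"
  assumes N: "pos_definite N" and M: "symmetric_matrix M"
  shows "\<exists>l. eigenvalue (matrix_inv N ** M) l \<and> (\<forall>v. l * (v \<bullet> (N *v v)) \<le> v \<bullet> (M *v v))"
proof -
  note iff = eigenvalue_matrix_inv_mult_iff[OF pos_definite_invertible[OF N]]
  obtain l where l: "eigenvalue (matrix_inv N ** - M) l"
    and le: "\<And>v. v \<bullet> ((- M) *v v) \<le> l * (v \<bullet> (N *v v))"
    using generalized_eigenvalue_ge_quotient[OF N symmetric_matrix_uminus[OF M]] by blast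
  obtain v where v: "v \<noteq> 0" "(- M) *v v = l *s (N *v v)" using l iff by blast
  then have "M *v v = (- l) *s (N *v v)"
    by (simp add: uminus_matrix_vector minus_equation_iff[of "M *v v"])
  then have "eigenvalue (matrix_inv N ** M) (- l)" using v(1) iff by blast
  moreover have "- l * (v \<bullet> (N *v v)) \<le> v \<bullet> (M *v v)" for v
    using le[of v] by (simp add: uminus_matrix_vector)
  ultimately show ?thesis by blast
qed

text \<open>The extreme eigenvalues are attained by finiteness, and they bound the quotients because
  some eigenvalue already does and \<open>v \<bullet> (N *v v)\<close> is nonnegative. Taking
  \<open>N\<close> as the identity covers \<open>X\<close>; taking \<open>N\<close> as
  \<open>S_upd\<close> covers \<open>matrix_inv S_upd ** S\<close>.\<close>

lemma
  fixes N M :: "real^'k^'k"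
  assumes N: "pos_definite N" and M: "symmetric_matrix M"
  shows eigenvalue_lambda_max: "eigenvalue (matrix_inv N ** M) (lambda_max (matrix_inv N ** M))"
    and eigenvalue_lambda_min: "eigenvalue (matrix_inv N ** M) (lambda_min (matrix_inv N ** M))"
    and quotient_le_lambda_max: "v \<bullet> (M *v v) \<le> lambda_max (matrix_inv N ** M) * (v \<bullet> (N *v v))"
    and lambda_min_le_quotient: "lambda_min (matrix_inv N ** M) * (v \<bullet> (N *v v)) \<le> v \<bullet> (M *v v)"
proof -
  let ?E = "{l. eigenvalue (matrix_inv N ** M) l}"
  have fin: "finite ?E" by (rule finite_generalized_eigenvalues[OF N M])
  have Nn: "v \<bullet> (N *v v) \<ge> 0"
    using N by (cases "v = 0") (auto simp: pos_definite_def less_imp_le)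
  obtain l where l: "l \<in> ?E" "\<And>v. v \<bullet> (M *v v) \<le> l * (v \<bullet> (N *v v))"
    using generalized_eigenvalue_ge_quotient[OF N M] by blast
  obtain k where k: "k \<in> ?E" "\<And>v. k * (v \<bullet> (N *v v)) \<le> v \<bullet> (M *v v)"
    using generalized_eigenvalue_le_quotient[OF N M] by blast
  show "eigenvalue (matrix_inv N ** M) (lambda_max (matrix_inv N ** M))"
    using Max_in[OF fin] l(1) by (auto simp: lambda_max_def)
  show "eigenvalue (matrix_inv N ** M) (lambda_min (matrix_inv N ** M))"
    using Min_in[OF fin] l(1) by (auto simp: lambda_min_def)
  have "l \<le> lambda_max (matrix_inv N ** M)"
    unfolding lambda_max_def by (rule Max_ge[OF fin l(1)])
  then show "v \<bullet> (M *v v) \<le> lambda_max (matrix_inv N ** M) * (v \<bullet> (N *v v))"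
    using l(2)[of v] Nn by (meson mult_right_mono order_trans)
  have "lambda_min (matrix_inv N ** M) \<le> k"
    unfolding lambda_min_def by (rule Min_le[OF fin k(1)])
  then show "lambda_min (matrix_inv N ** M) * (v \<bullet> (N *v v)) \<le> v \<bullet> (M *v v)"
    using k(2)[of v] Nn by (meson mult_right_mono order_trans)
qed

subsection \<open>Diagonal and block matrices\<close>

lemma symmetric_matrix_diag_powr [simp]: "symmetric_matrix (diag_powr D p)"
  by (simp add: symmetric_matrix_def transpose_def vec_eq_iff diag_powr_def)

lemma diag_powr_vector_nth [simp]: "(diag_powr D p *v v) $ i = (D $ i $ i) powr p * v $ i"
  by (simp add: matrix_vector_mult_def diag_powr_def if_distrib[of "\<lambda>c. c * _"] cong: if_cong)

lemma diag_powr_mult: "diag_powr D p ** diag_powr D q = diag_powr D (p + q)"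
  by (simp add: matrix_eq vec_eq_iff powr_add flip: matrix_vector_mul_assoc)

text \<open>Positivity matters here because \<open>0 powr 0 = 0\<close>.\<close>

lemma diag_powr_0:
  assumes "\<And>i. 0 < D $ i $ i"
  shows "diag_powr D 0 = mat 1"
  using less_imp_neq[OF assms] by (simp add: matrix_eq vec_eq_iff)

lemma diag_powr_1:
  assumes "\<And>i. 0 < D $ i $ i" "diagonal_matrix D"
  shows "diag_powr D 1 = D"
  using assms by (auto simp: vec_eq_iff diag_powr_def diagonal_matrix_def less_imp_le)

lemma matrix_inv_diagonal:
  assumes "\<And>i. 0 < D $ i $ i" "diagonal_matrix D"
  shows "matrix_inv D = diag_powr D (- 1)"
  using diag_powr_mult[of D "1" "- 1"] diag_powr_mult[of D "- 1" "1"] assms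
  by (intro matrix_inv_unique) (simp_all add: diag_powr_0 diag_powr_1)

lemma diagonal_inv_quadratic_form:
  assumes "\<And>i. 0 < D $ i $ i" "diagonal_matrix D"
  shows "v \<bullet> (matrix_inv D *v v) = (\<Sum>i\<in>UNIV. (v $ i)\<^sup>2 / D $ i $ i)"
  using assms by (simp add: matrix_inv_diagonal inner_vec_def powr_minus_divide powr_one less_imp_le
      power2_eq_square)

lemma sum_UNIV_Plus:
  fixes f :: "'a::finite + 'b::finite \<Rightarrow> 'c::comm_monoid_add"
  shows "sum f UNIV = (\<Sum>a\<in>UNIV. f (Inl a)) + (\<Sum>b\<in>UNIV. f (Inr b))"
  by (simp add: sum.Plus flip: UNIV_Plus_UNIV)

lemma block_vector_eq_iff [simp]:
  "block_vector x y = block_vector x' y' \<longleftrightarrow> x = x' \<and> y = y'"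
  by (auto simp: block_vector_def vec_eq_iff split: sum.splits)

lemma block_vector_eq_0_iff [simp]: "block_vector x y = 0 \<longleftrightarrow> x = 0 \<and> y = 0"
  by (auto simp: block_vector_def vec_eq_iff split: sum.splits)

lemma block_vector_exhaust:
  obtains x y where "v = block_vector x y"
proof
  show "v = block_vector (\<chi> i. v $ Inl i) (\<chi> i. v $ Inr i)"
    by (auto simp: block_vector_def vec_eq_iff split: sum.splits)
qed

lemma block_matrix_vector_mult:
  fixes A :: "'a::semiring_1^'r^'p"
  shows "block_matrix A B C D *v block_vector x y = block_vector (A *v x + B *v y) (C *v x + D *v y)"
  by (auto simp: block_vector_def block_matrix_def vec_eq_iff matrix_vector_mult_def sum_UNIV_Plus
      split: sum.splits)

section \<open>Real and imaginary parts of complex eigenvectors\<close>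

definition Re_vec :: "complex^'k \<Rightarrow> real^'k" where "Re_vec v = (\<chi> i. Re (v $ i))"

definition Im_vec :: "complex^'k \<Rightarrow> real^'k" where "Im_vec v = (\<chi> i. Im (v $ i))"

lemma Re_vec_eq_Im_vec_eq_0_iff: "Re_vec v = 0 \<and> Im_vec v = 0 \<longleftrightarrow> v = 0"
  by (auto simp: Re_vec_def Im_vec_def vec_eq_iff complex_eq_iff)

lemma Re_vec_block [simp]: "Re_vec (block_vector x y) = block_vector (Re_vec x) (Re_vec y)"
  by (auto simp: Re_vec_def block_vector_def vec_eq_iff split: sum.splits)

lemma Im_vec_block [simp]: "Im_vec (block_vector x y) = block_vector (Im_vec x) (Im_vec y)"
  by (auto simp: Im_vec_def block_vector_def vec_eq_iff split: sum.splits)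

text \<open>A real matrix commutes with taking real and imaginary parts. A complex eigenpair thus
  becomes two coupled real equations, and real inner products suffice afterwards.\<close>

lemma complex_eigenvector_Re_Im:
  assumes "eigenvector (complex_matrix M) v l"
  shows "M *v Re_vec v = Re l *\<^sub>R Re_vec v - Im l *\<^sub>R Im_vec v"
    and "M *v Im_vec v = Re l *\<^sub>R Im_vec v + Im l *\<^sub>R Re_vec v"
proof -
  have eq: "(\<Sum>j\<in>UNIV. complex_of_real (M $ i $ j) * v $ j) = l * v $ i" for i
    using assms by (simp add: eigenvector_def vec_eq_iff matrix_vector_mult_def)
  show "M *v Re_vec v = Re l *\<^sub>R Re_vec v - Im l *\<^sub>R Im_vec v"
    using arg_cong[OF eq, of Re] by (simp add: vec_eq_iff matrix_vector_mult_def Re_vec_def Im_vec_def)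
  show "M *v Im_vec v = Re l *\<^sub>R Im_vec v + Im l *\<^sub>R Re_vec v"
    using arg_cong[OF eq, of Im] by (simp add: vec_eq_iff matrix_vector_mult_def Re_vec_def Im_vec_def)
qed

lemma matrix_norm2_bound: "norm (M *v v) \<le> matrix_norm2 M * norm v"
  unfolding matrix_norm2_def by (rule onorm) (rule matrix_vector_mul_bounded_linear)

lemma matrix_norm2_nonneg: "0 \<le> matrix_norm2 M"
  unfolding matrix_norm2_def by (rule onorm_pos_le) (rule matrix_vector_mul_bounded_linear)

subsection \<open>The preconditioned saddle-point system\<close>

text \<open>Real and imaginary parts are kept apart: \<open>w = w1 + \<i> w2\<close>, \<open>\<lambda> = \<alpha> + \<i> \<beta>\<close>, and similarly for the
  other vectors; \<open>c\<close> and \<open>d\<close> are the real and imaginary parts of \<open>w\<^sup>* E z\<close>.\<close>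

lemma saddle_real_identities:
  fixes X E K :: "real^'n^'n" and T :: "real^'m^'m" and B :: "real^'n^'m"
  assumes sym: "symmetric_matrix X" "symmetric_matrix E" "symmetric_matrix K" "symmetric_matrix T"
    and z: "z1 = transpose B *v y1" "z2 = transpose B *v y2"
    and eqs: "X *v w1 + E *v z1 = \<alpha> *\<^sub>R w1 - \<beta> *\<^sub>R w2"
      "X *v w2 + E *v z2 = \<alpha> *\<^sub>R w2 + \<beta> *\<^sub>R w1"
      "B *v (K *v z1 - E *v w1) = T *v (\<alpha> *\<^sub>R y1 - \<beta> *\<^sub>R y2)"
      "B *v (K *v z2 - E *v w2) = T *v (\<alpha> *\<^sub>R y2 + \<beta> *\<^sub>R y1)"
  defines "a \<equiv> w1 \<bullet> w1 + w2 \<bullet> w2" and "b \<equiv> y1 \<bullet> (T *v y1) + y2 \<bullet> (T *v y2)"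
    and "c \<equiv> w1 \<bullet> (E *v z1) + w2 \<bullet> (E *v z2)" and "d \<equiv> w1 \<bullet> (E *v z2) - w2 \<bullet> (E *v z1)"
  shows "w1 \<bullet> (X *v w1) + w2 \<bullet> (X *v w2) + c = \<alpha> * a"
    and "z1 \<bullet> (K *v z1) + z2 \<bullet> (K *v z2) - c = \<alpha> * b"
    and "d = \<beta> * a"
    and "d = \<beta> * b"
proof -
  have swap: "u \<bullet> (M *v v) = v \<bullet> (M *v u)" if "symmetric_matrix M" for u v and M :: "real^'l^'l"
    using symmetric_matrix_dot[OF that, of u v] by (simp add: inner_commute)
  have yB: "y1 \<bullet> (B *v v) = z1 \<bullet> v" "y2 \<bullet> (B *v v) = z2 \<bullet> v" for v
    by (simp_all add: z dot_matrix_vector_transpose)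
  note simps = inner_add_right inner_diff_right yB matrix_vector_mult_diff_distrib
    matrix_vector_right_distrib matrix_vector_mult_scaleR
  \<comment> \<open>Pairings with equal indices add up to the real part of the complex inner
    product; the difference of the crossed pairings is its imaginary part, to which symmetric
    matrices contribute nothing.\<close>
  note e1 = eqs(1)[THEN arg_cong[where f = "inner w1"]] eqs(2)[THEN arg_cong[where f = "inner w2"]]
    eqs(1)[THEN arg_cong[where f = "inner w2"]] eqs(2)[THEN arg_cong[where f = "inner w1"]]
  note e2 = eqs(3)[THEN arg_cong[where f = "inner y1"]] eqs(4)[THEN arg_cong[where f = "inner y2"]]
    eqs(3)[THEN arg_cong[where f = "inner y2"]] eqs(4)[THEN arg_cong[where f = "inner y1"]]
  show "w1 \<bullet> (X *v w1) + w2 \<bullet> (X *v w2) + c = \<alpha> * a"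
    using e1(1,2) by (simp add: simps a_def c_def inner_commute[of w2 w1] algebra_simps)
  show "d = \<beta> * a"
    using e1(3,4) swap[OF sym(1), of w1 w2]
    by (simp add: simps a_def d_def inner_commute[of w2 w1] algebra_simps)
  \<comment> \<open>In the second equation the coupling is \<open>- z\<^sup>* E w\<close>, the
    negative conjugate of \<open>w\<^sup>* E z\<close> as \<open>E\<close> is symmetric. So
    \<open>c\<close> changes sign here while \<open>d\<close> keeps its sign in the last
    identity.\<close>
  show "z1 \<bullet> (K *v z1) + z2 \<bullet> (K *v z2) - c = \<alpha> * b"
    using e2(1,2) swap[OF sym(2), of w1 z1] swap[OF sym(2), of w2 z2] swap[OF sym(4), of y1 y2]
    by (simp add: simps b_def c_def algebra_simps)
  show "d = \<beta> * b"
    using e2(3,4) swap[OF sym(2), of w1 z2] swap[OF sym(2), of w2 z1] swap[OF sym(4), of y1 y2]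
      swap[OF sym(3), of z1 z2]
    by (simp add: simps b_def d_def algebra_simps)
qed

text \<open>Multiplied out, the factors give the block rows \<open>G, transpose A\<close> and
  \<open>A, A ** matrix_inv G ** transpose A - T\<close>. The off-diagonal blocks are those of the
  saddle-point matrix.\<close>

lemma preconditioner_vector_mult:
  fixes G :: "real^'n^'n" and A :: "real^'n^'m" and T :: "real^'m^'m"
  assumes "invertible G"
  shows "(block_matrix (mat 1) 0 (A ** matrix_inv G) (mat 1) ** block_matrix G 0 0 (- T)
      ** block_matrix (mat 1) (matrix_inv G ** transpose A) 0 (mat 1)) *v block_vector r s
    = block_vector (G *v r + transpose A *v s)
        (A *v r + (A ** matrix_inv G ** transpose A) *v s - T *v s)"
proof -
  have [simp]: "matrix_inv G *v (G *v v) = v" "G *v (matrix_inv G *v v) = v" for v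
    using matrix_inv_mult[OF assms] by (simp_all add: matrix_vector_mul_assoc)
  show ?thesis
    by (simp add: block_matrix_vector_mult matrix_vector_right_distrib uminus_matrix_vector
        flip: matrix_vector_mul_assoc)
qed

lemma two_mat_1_diff_vector:
  fixes X :: "real^'n^'n"
  shows "(2 *\<^sub>R mat 1 - X) *v v = 2 *\<^sub>R v - X *v v"
  unfolding matrix_vector_mult_diff_rdistrib scaleR_matrix_vector_assoc[symmetric] by simp

text \<open>Here \<open>r\<close> and \<open>s\<close> stand for the components of the eigenvalue
  times the eigenvector. Leaving them free lets one lemma serve both the real and the imaginary
  equations.\<close>

lemma scaled_saddle_equations:
  fixes H G R Rp X :: "real^'n^'n" and A :: "real^'n^'m" and T :: "real^'m^'m"
  assumes pos: "\<And>i. 0 < G $ i $ i" and diag: "diagonal_matrix G"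
    and R: "R = diag_powr G (- 1/2)" and Rp: "Rp = diag_powr G (1/2)"
    and X: "X = R ** H ** R"
    and eq1: "H *v x + transpose A *v y = G *v r + transpose A *v s"
    and eq2: "A *v x = A *v r + (A ** matrix_inv G ** transpose A) *v s - T *v s"
  defines "w \<equiv> Rp *v x + R *v (transpose A *v y)" and "z \<equiv> R *v (transpose A *v y)"
  shows "X *v w + (mat 1 - X) *v z = Rp *v r + R *v (transpose A *v s)"
    and "(A ** R) *v ((2 *\<^sub>R mat 1 - X) *v z - (mat 1 - X) *v w) = T *v s"
proof -
  have RRp: "R *v (Rp *v v) = v" for v
    by (simp add: matrix_vector_mul_assoc R Rp diag_powr_mult diag_powr_0[OF pos])
  have RG: "R *v (G *v v) = Rp *v v" for v
    using diag_powr_mult[of G "- 1/2" 1]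
    by (simp add: matrix_vector_mul_assoc R Rp diag_powr_1[OF pos diag])
  have RR: "R *v (R *v v) = matrix_inv G *v v" for v
    by (simp add: matrix_vector_mul_assoc R diag_powr_mult matrix_inv_diagonal[OF pos diag])
  have "X *v w + (mat 1 - X) *v z = R *v (H *v x + transpose A *v y)"
    by (simp add: X w_def z_def RRp matrix_vector_right_distrib matrix_vector_mult_diff_rdistrib
        flip: matrix_vector_mul_assoc)
  also have "\<dots> = Rp *v r + R *v (transpose A *v s)"
    unfolding eq1 by (simp add: RG matrix_vector_right_distrib)
  finally show 1: "X *v w + (mat 1 - X) *v z = Rp *v r + R *v (transpose A *v s)" .
  \<comment> \<open>As \<open>2 z - w = z - Rp x\<close>, this vector is the left side of the first
    claim minus \<open>Rp x\<close>, so the first claim can be reused.\<close>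
  have "(2 *\<^sub>R mat 1 - X) *v z - (mat 1 - X) *v w = (X *v w + (mat 1 - X) *v z) - Rp *v x"
    unfolding two_mat_1_diff_vector w_def z_def[symmetric]
    by (simp add: matrix_vector_mult_diff_rdistrib scaleR_2)
  then have "(A ** R) *v ((2 *\<^sub>R mat 1 - X) *v z - (mat 1 - X) *v w)
      = A *v (R *v (Rp *v r + R *v (transpose A *v s) - Rp *v x))"
    by (simp add: 1 flip: matrix_vector_mul_assoc)
  also have "\<dots> = A *v r + (A ** matrix_inv G ** transpose A) *v s - A *v x"
    by (simp add: RRp RR matrix_vector_right_distrib matrix_vector_mult_diff_distrib
        flip: matrix_vector_mul_assoc)
  finally show "(A ** R) *v ((2 *\<^sub>R mat 1 - X) *v z - (mat 1 - X) *v w) = T *v s"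
    by (simp add: eq2)
qed

section \<open>Averages, quadratic forms and norms\<close>

text \<open>The number \<open>t\<close> is the average of \<open>p / a\<close> and
  \<open>q / b\<close> with weights \<open>a\<close> and \<open>b\<close>. The form without division
  allows one weight to vanish.\<close>

lemma weighted_average_bounds:
  fixes a b :: real
  assumes "0 \<le> a" "0 \<le> b" "0 < a + b" "t * (a + b) = p + q"
    and "l1 * a \<le> p" "p \<le> u1 * a" "l2 * b \<le> q" "q \<le> u2 * b"
  shows "min l1 l2 \<le> t" "t \<le> max u1 u2"
proof -
  have "min l1 l2 * (a + b) \<le> l1 * a + l2 * b"
    using assms(1,2) by (simp add: distrib_left add_mono mult_right_mono)
  then have "min l1 l2 * (a + b) \<le> t * (a + b)" using assms by linarith
  then show "min l1 l2 \<le> t" using assms(3) by simp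
  have "u1 * a + u2 * b \<le> max u1 u2 * (a + b)"
    using assms(1,2) by (simp add: distrib_left add_mono mult_right_mono)
  then have "t * (a + b) \<le> max u1 u2 * (a + b)" using assms by linarith
  then show "t \<le> max u1 u2" using assms(3) by simp
qed

text \<open>Full row rank makes \<open>transpose A\<close> injective, so the form at a nonzero
  \<open>v\<close> is a sum of weighted squares of a nonzero vector.\<close>

lemma full_row_rank_congruence_pos_definite:
  fixes A :: "real^'n^'m"
  assumes "rank A = CARD('m)" and J: "diagonal_matrix J" "\<And>i. 0 < J $ i $ i"
  shows "pos_definite (A ** matrix_inv J ** transpose A)"
  unfolding pos_definite_def
proof (intro conjI allI impI)
  show "symmetric_matrix (A ** matrix_inv J ** transpose A)"
    by (intro symmetric_matrix_congruence) (simp add: matrix_inv_diagonal[OF J(2,1)])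
  fix v :: "real^'m" assume "v \<noteq> 0"
  moreover have "inj ((*v) (transpose A))"
    using assms(1) by (simp add: rank_transpose flip: full_rank_injective)
  ultimately have "transpose A *v v \<noteq> 0"
    by (metis injD matrix_vector_mult_0_right)
  then obtain i where "(transpose A *v v) $ i \<noteq> 0" by (auto simp: vec_eq_iff)
  then have "0 < (transpose A *v v) \<bullet> (matrix_inv J *v (transpose A *v v))"
    unfolding diagonal_inv_quadratic_form[OF J(2,1)] using J(2)
    by (intro sum_pos2[of _ i]) (auto simp: less_imp_le)
  then show "0 < v \<bullet> ((A ** matrix_inv J ** transpose A) *v v)"
    by (simp add: dot_matrix_vector_transpose[of v A] flip: matrix_vector_mul_assoc)
qed

text \<open>Both forms are sums of weighted squares, and corresponding terms differ by the factor
  \<open>J $ i $ i / G $ i $ i\<close>.\<close>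

lemma diagonal_inv_quadratic_form_bounds:
  fixes G J :: "real^'n^'n"
  assumes G: "\<And>i. 0 < G $ i $ i" "diagonal_matrix G" and J: "\<And>i. 0 < J $ i $ i" "diagonal_matrix J"
  shows "Min (range (\<lambda>i. J $ i $ i / G $ i $ i)) * (v \<bullet> (matrix_inv J *v v)) \<le> v \<bullet> (matrix_inv G *v v)"
    and "v \<bullet> (matrix_inv G *v v) \<le> Max (range (\<lambda>i. J $ i $ i / G $ i $ i)) * (v \<bullet> (matrix_inv J *v v))"
proof -
  have split: "v \<bullet> (matrix_inv G *v v) = (\<Sum>i\<in>UNIV. (J $ i $ i / G $ i $ i) * ((v $ i)\<^sup>2 / J $ i $ i))"
    unfolding diagonal_inv_quadratic_form[OF G] using less_imp_neq[OF J(1)]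
    by (intro sum.cong) (auto simp: field_simps)
  have nn: "0 \<le> (v $ i)\<^sup>2 / J $ i $ i" for i using J(1)[of i] by simp
  show "Min (range (\<lambda>i. J $ i $ i / G $ i $ i)) * (v \<bullet> (matrix_inv J *v v)) \<le> v \<bullet> (matrix_inv G *v v)"
    unfolding split unfolding diagonal_inv_quadratic_form[OF J] sum_distrib_left
    by (intro sum_mono mult_right_mono nn Min_le) auto
  show "v \<bullet> (matrix_inv G *v v) \<le> Max (range (\<lambda>i. J $ i $ i / G $ i $ i)) * (v \<bullet> (matrix_inv J *v v))"
    unfolding split unfolding diagonal_inv_quadratic_form[OF J] sum_distrib_left
    by (intro sum_mono mult_right_mono nn Max_ge) auto
qed

text \<open>The left side is the modulus of the imaginary part of \<open>w\<^sup>* E z\<close>.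
  Cauchy-Schwarz is used for each product and then in the plane for the pairs of norms.\<close>

lemma norm_cross_bound:
  fixes w1 w2 z1 z2 :: "real^'n"
  shows "\<bar>w1 \<bullet> (E *v z2) - w2 \<bullet> (E *v z1)\<bar>
    \<le> matrix_norm2 E * (sqrt (w1 \<bullet> w1 + w2 \<bullet> w2) * sqrt (z1 \<bullet> z1 + z2 \<bullet> z2))"
proof -
  have bound: "\<bar>u \<bullet> (E *v v)\<bar> \<le> matrix_norm2 E * (norm u * norm v)" for u v :: "real^'n"
    using Cauchy_Schwarz_ineq2[of u "E *v v"] mult_left_mono[OF matrix_norm2_bound[of E v], of "norm u"]
    by (simp add: mult.left_commute)
  have "(norm w1, norm w2) \<bullet> (norm z2, norm z1) \<le> norm (norm w1, norm w2) * norm (norm z2, norm z1)"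
    by (rule norm_cauchy_schwarz)
  then have "norm w1 * norm z2 + norm w2 * norm z1
      \<le> sqrt (w1 \<bullet> w1 + w2 \<bullet> w2) * sqrt (z1 \<bullet> z1 + z2 \<bullet> z2)"
    by (simp add: norm_Pair dot_square_norm add.commute)
  then show ?thesis
    using bound[of w1 z2] bound[of w2 z1] mult_left_mono[OF _ matrix_norm2_nonneg[of E]]
    by (smt (verit) distrib_left)
qed

theorem corollary3p2:
  fixes Q \<Theta> G J X :: "real^'n^'n"
    and A :: "real^'n^'m"
    and S S_upd :: "real^'m^'m"
    and \<A> P_upd :: "real^('n + 'm)^('n + 'm)"
    and \<gamma>1 \<gamma>n lam_up lam_low :: real
    and lam :: complex and x :: "complex^'n" and y :: "complex^'m"
  assumes "CARD('m) \<le> CARD('n)"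
    and "pos_semidefinite Q"
    and "rank A = min CARD('m) CARD('n)"
    and "diagonal_matrix \<Theta>" and "pos_definite \<Theta>"
    and "diagonal_matrix J" and "pos_definite J"
    and "G = diag_part (Q + \<Theta>)"
    and "S = A ** matrix_inv G ** transpose A"
    and "S_upd = A ** matrix_inv J ** transpose A"
    and "\<A> = block_matrix (Q + \<Theta>) (transpose A) A 0"
    and "P_upd = block_matrix (mat 1) 0 (A ** matrix_inv G) (mat 1)
                 ** block_matrix G 0 0 (- S_upd)
                 ** block_matrix (mat 1) (matrix_inv G ** transpose A) 0 (mat 1)"
    and "\<gamma>1 = Min (range (\<lambda>i. J $ i $ i / G $ i $ i))"
    and "\<gamma>n = Max (range (\<lambda>i. J $ i $ i / G $ i $ i))"
    and "X = diag_powr G (- 1/2) ** (Q + \<Theta>) ** diag_powr G (- 1/2)"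
    and "pos_definite (2 *\<^sub>R mat 1 - X)"
    and "lam_up = lambda_max (matrix_inv S_upd ** S) * (2 - lambda_min X)"
    and "lam_low = lambda_min (matrix_inv S_upd ** S) * (2 - lambda_max X)"
    and "eigenvector (complex_matrix (matrix_inv P_upd ** \<A>)) (block_vector x y) lam"
  shows "(Im lam \<noteq> 0 \<longrightarrow>
            1/2 * (lambda_min X + lam_low) \<le> Re lam \<and>
            Re lam \<le> 1/2 * (lambda_max X + lam_up)) \<and>
         (Im lam = 0 \<longrightarrow>
            (y \<noteq> 0 \<longrightarrow> min (lambda_min X) lam_low \<le> Re lam \<and>
                      Re lam \<le> max (lambda_max X) lam_up) \<and>
            (y = 0 \<longrightarrow> lambda_min X \<le> Re lam \<and> Re lam \<le> lambda_max X)) \<and>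
         lam_up \<le> \<gamma>n * (2 - lambda_min X) \<and>
         lam_low \<ge> \<gamma>1 * (2 - lambda_max X) \<and>
         \<bar>Im lam\<bar> \<le> sqrt \<gamma>n * matrix_norm2 (mat 1 - X)"
proof -

  \<comment> \<open>The scaled matrix \<open>X\<close> and its spectrum\<close>
  define H where "H = Q + \<Theta>"
  define R where "R = diag_powr G (- 1/2)"
  define Rp where "Rp = diag_powr G (1/2)"
  define E where "E = mat 1 - X"
  define K where "K = 2 *\<^sub>R mat 1 - X"
  have symH: "symmetric_matrix H"
    using assms(2,5) by (simp add: H_def pos_semidefinite_def pos_definite_def symmetric_matrix_def
        transpose_def vec_eq_iff)
  have pdH: "pos_definite H"
    using assms(2,5) symH
    by (auto simp: H_def pos_semidefinite_def pos_definite_def matrix_vector_mult_add_rdistrib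
        inner_add_right add_nonneg_pos)
  have Gpos: "0 < G $ i $ i" for i
    using pos_definite_diag_pos[OF pdH, of i] by (simp add: assms(8) diag_part_def flip: H_def)
  have Gdiag: "diagonal_matrix G" by (simp add: assms(8) diag_part_def diagonal_matrix_def)
  have Jpos: "0 < J $ i $ i" for i by (rule pos_definite_diag_pos[OF assms(7)])
  note Jdiag = assms(6)
  have Gpd: "invertible G"
    using diag_powr_mult[of G 1 "- 1"] diag_powr_mult[of G "- 1" 1]
    by (auto simp: invertible_def diag_powr_0[OF Gpos] diag_powr_1[OF Gpos Gdiag])
  have rank: "rank A = CARD('m)" using assms(1,3) by simp
  have X: "X = R ** H ** R" using assms(15) by (simp add: R_def H_def)
  have symX: "symmetric_matrix X"
    using symmetric_matrix_congruence[OF symH, of R] symmetric_matrix_diag_powr[of G "- 1/2"]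
    by (simp add: X R_def symmetric_matrix_def)
  have symE: "symmetric_matrix E" and symK: "symmetric_matrix K"
    by (simp_all add: E_def K_def symX symmetric_matrix_diff symmetric_matrix_scaleR)
  have inv1: "matrix_inv (mat 1) ** X = X"
    by (simp add: matrix_inv_unique[of "mat 1" "mat 1"])
  define lo where "lo = lambda_min X"
  define hi where "hi = lambda_max X"
  have X_bounds: "lo * (v \<bullet> v) \<le> v \<bullet> (X *v v)" "v \<bullet> (X *v v) \<le> hi * (v \<bullet> v)" for v
    using lambda_min_le_quotient[OF pos_definite_mat_1 symX, of v]
      quotient_le_lambda_max[OF pos_definite_mat_1 symX, of v] by (simp_all add: inv1 lo_def hi_def)
  have K_form: "v \<bullet> (K *v v) = 2 * (v \<bullet> v) - v \<bullet> (X *v v)" for v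
    unfolding K_def two_mat_1_diff_vector by (simp add: inner_diff_right)
  have eig_less_2: "l < 2" if l: "eigenvalue X l" for l
  proof -
    obtain v where v: "v \<noteq> 0" "X *v v = l *\<^sub>R v"
      using l by (auto simp: eigenvalue_def eigenvector_def scalar_mult_eq_scaleR)
    have "0 < v \<bullet> (K *v v)" using assms(16) v(1) by (simp add: pos_definite_def K_def)
    also have "\<dots> = (2 - l) * (v \<bullet> v)" by (simp add: K_form v(2) left_diff_distrib)
    finally show ?thesis using inner_ge_zero[of v] by (simp add: zero_less_mult_iff)
  qed
  \<comment> \<open>Positivity of \<open>2 - lo\<close> and \<open>2 - hi\<close> allows
    inequalities to be multiplied by these factors.\<close>
  have less_2: "lo < 2" "hi < 2"
    using eigenvalue_lambda_min[OF pos_definite_mat_1 symX] eigenvalue_lambda_max[OF pos_definite_mat_1 symX]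
    by (auto intro: eig_less_2 simp: inv1 lo_def hi_def)

  \<comment> \<open>Comparison of \<open>S\<close> with \<open>S_upd\<close>\<close>
  have Tpd: "pos_definite S_upd"
    unfolding assms(10) by (rule full_row_rank_congruence_pos_definite[OF rank Jdiag Jpos])
  then have symT: "symmetric_matrix S_upd" by (simp add: pos_definite_def)
  have symS: "symmetric_matrix S"
    unfolding assms(9) by (intro symmetric_matrix_congruence) (simp add: matrix_inv_diagonal[OF Gpos Gdiag])
  have S_form: "v \<bullet> (S *v v) = (transpose A *v v) \<bullet> (matrix_inv G *v (transpose A *v v))"
    and T_form: "v \<bullet> (S_upd *v v) = (transpose A *v v) \<bullet> (matrix_inv J *v (transpose A *v v))" for v
    by (simp_all add: assms(9,10) dot_matrix_vector_transpose[of v A] flip: matrix_vector_mul_assoc)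
  have \<gamma>_bounds: "\<gamma>1 * (v \<bullet> (S_upd *v v)) \<le> v \<bullet> (S *v v)"
      "v \<bullet> (S *v v) \<le> \<gamma>n * (v \<bullet> (S_upd *v v))" for v
    unfolding S_form T_form assms(13,14)
    by (rule diagonal_inv_quadratic_form_bounds[OF Gpos Gdiag Jpos Jdiag])+
  define slo where "slo = lambda_min (matrix_inv S_upd ** S)"
  define shi where "shi = lambda_max (matrix_inv S_upd ** S)"
  have S_bounds: "slo * (v \<bullet> (S_upd *v v)) \<le> v \<bullet> (S *v v)"
      "v \<bullet> (S *v v) \<le> shi * (v \<bullet> (S_upd *v v))" for v
    unfolding slo_def shi_def
    by (rule lambda_min_le_quotient[OF Tpd symS] quotient_le_lambda_max[OF Tpd symS])+
  \<comment> \<open>At an eigenvector the quotient of the two forms equals the eigenvalue, so the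
    bounds on all quotients apply to it.\<close>
  have eig_\<gamma>: "\<gamma>1 \<le> l \<and> l \<le> \<gamma>n" if l: "eigenvalue (matrix_inv S_upd ** S) l" for l
  proof -
    obtain v where v: "v \<noteq> 0" "S *v v = l *\<^sub>R (S_upd *v v)"
      using l eigenvalue_matrix_inv_mult_iff[OF pos_definite_invertible[OF Tpd]]
      by (auto simp: scalar_mult_eq_scaleR)
    have "0 < v \<bullet> (S_upd *v v)" using Tpd v(1) by (simp add: pos_definite_def)
    then show ?thesis using \<gamma>_bounds[of v] v(2) by simp
  qed
  have s_\<gamma>: "\<gamma>1 \<le> slo" "shi \<le> \<gamma>n"
    using eig_\<gamma> eigenvalue_lambda_min[OF Tpd symS] eigenvalue_lambda_max[OF Tpd symS]
    by (auto simp: slo_def shi_def)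
  have up: "lam_up = shi * (2 - lo)" and low: "lam_low = slo * (2 - hi)"
    using assms(17,18) by (simp_all add: lo_def hi_def slo_def shi_def)
  have \<gamma>_concl: "lam_up \<le> \<gamma>n * (2 - lo)" "lam_low \<ge> \<gamma>1 * (2 - hi)"
    unfolding up low using s_\<gamma> less_2 by (simp_all add: mult_right_mono)

  \<comment> \<open>Invertibility of the preconditioner\<close>
  have P_mult: "P_upd *v block_vector r s
      = block_vector (G *v r + transpose A *v s) (A *v r + S *v s - S_upd *v s)" for r s
    unfolding assms(12) assms(9) by (rule preconditioner_vector_mult[OF Gpd])
  have A_mult: "\<A> *v block_vector r s = block_vector (H *v r + transpose A *v s) (A *v r)" for r s
    by (simp add: assms(11) block_matrix_vector_mult H_def)
  have P_inv: "invertible P_upd"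
  proof (rule invertible_if_kernel_trivial)
    fix v assume "P_upd *v v = 0"
    moreover obtain r s where v: "v = block_vector r s" by (rule block_vector_exhaust)
    ultimately have eqs: "G *v r + transpose A *v s = 0" "A *v r + S *v s - S_upd *v s = 0"
      by (simp_all add: P_mult)
    have Gi: "matrix_inv G *v (G *v u) = u" for u
      using matrix_inv_mult[OF Gpd] by (simp add: matrix_vector_mul_assoc)
    \<comment> \<open>Block elimination: the first row gives
      \<open>r = - G\<^sup>-\<^sup>1 A\<^sup>T s\<close>, and the second then collapses to
      \<open>S_upd s = 0\<close>.\<close>
    have "matrix_inv G *v (G *v r + transpose A *v s) = 0" unfolding eqs by simp
    then have r: "r + matrix_inv G *v (transpose A *v s) = 0"
      by (simp add: matrix_vector_right_distrib Gi)
    have "A *v r + S *v s = A *v (r + matrix_inv G *v (transpose A *v s))"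
      by (simp add: assms(9) matrix_vector_right_distrib flip: matrix_vector_mul_assoc)
    then have "S_upd *v s = 0" using eqs(2) unfolding r by simp
    then have "s \<bullet> (S_upd *v s) = 0" by simp
    then have s: "s = 0" using Tpd by (metis less_irrefl pos_definite_def)
    then show "v = 0" using r by (simp add: v)
  qed

  \<comment> \<open>The scaled equations for real and imaginary parts\<close>
  define \<alpha> where "\<alpha> = Re lam"
  define \<beta> where "\<beta> = Im lam"
  define x1 where "x1 = Re_vec x"
  define x2 where "x2 = Im_vec x"
  define y1 where "y1 = Re_vec y"
  define y2 where "y2 = Im_vec y"
  \<comment> \<open>Invertibility of \<open>P_upd\<close> moves it to the right side;
    \<open>matrix_inv\<close> of a singular matrix would be unspecified.\<close>
  have eig: "\<A> *v block_vector x1 y1 = P_upd *v (\<alpha> *\<^sub>R block_vector x1 y1 - \<beta> *\<^sub>R block_vector x2 y2)"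
      "\<A> *v block_vector x2 y2 = P_upd *v (\<alpha> *\<^sub>R block_vector x2 y2 + \<beta> *\<^sub>R block_vector x1 y1)"
    using complex_eigenvector_Re_Im[OF assms(19)] unfolding Re_vec_block Im_vec_block
    by (simp_all add: matrix_inv_vector_eq_iff[OF P_inv] x1_def x2_def y1_def y2_def \<alpha>_def \<beta>_def
        flip: matrix_vector_mul_assoc)
  have block: "\<alpha> *\<^sub>R block_vector x1 y1 - \<beta> *\<^sub>R block_vector x2 y2
        = block_vector (\<alpha> *\<^sub>R x1 - \<beta> *\<^sub>R x2) (\<alpha> *\<^sub>R y1 - \<beta> *\<^sub>R y2)"
      "\<alpha> *\<^sub>R block_vector x2 y2 + \<beta> *\<^sub>R block_vector x1 y1
        = block_vector (\<alpha> *\<^sub>R x2 + \<beta> *\<^sub>R x1) (\<alpha> *\<^sub>R y2 + \<beta> *\<^sub>R y1)"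
    by (auto simp: block_vector_def vec_eq_iff split: sum.splits)
  have eqs:
      "H *v x1 + transpose A *v y1
        = G *v (\<alpha> *\<^sub>R x1 - \<beta> *\<^sub>R x2) + transpose A *v (\<alpha> *\<^sub>R y1 - \<beta> *\<^sub>R y2)"
      "A *v x1 = A *v (\<alpha> *\<^sub>R x1 - \<beta> *\<^sub>R x2) + (A ** matrix_inv G ** transpose A) *v (\<alpha> *\<^sub>R y1 - \<beta> *\<^sub>R y2)
        - S_upd *v (\<alpha> *\<^sub>R y1 - \<beta> *\<^sub>R y2)"
      "H *v x2 + transpose A *v y2
        = G *v (\<alpha> *\<^sub>R x2 + \<beta> *\<^sub>R x1) + transpose A *v (\<alpha> *\<^sub>R y2 + \<beta> *\<^sub>R y1)"
      "A *v x2 = A *v (\<alpha> *\<^sub>R x2 + \<beta> *\<^sub>R x1) + (A ** matrix_inv G ** transpose A) *v (\<alpha> *\<^sub>R y2 + \<beta> *\<^sub>R y1)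
        - S_upd *v (\<alpha> *\<^sub>R y2 + \<beta> *\<^sub>R y1)"
    using eig unfolding block A_mult P_mult block_vector_eq_iff assms(9) by blast+
  define z1 where "z1 = R *v (transpose A *v y1)"
  define z2 where "z2 = R *v (transpose A *v y2)"
  \<comment> \<open>The right triangular factor of \<open>P_upd\<close> maps the eigenvector to a
    vector with first component \<open>x + G\<^sup>-\<^sup>1 A\<^sup>T y\<close>; \<open>w\<close>
    is this component scaled by \<open>G\<^sup>1\<^sup>/\<^sup>2\<close>.\<close>
  define w1 where "w1 = Rp *v x1 + z1"
  define w2 where "w2 = Rp *v x2 + z2"
  note scaled = scaled_saddle_equations[OF Gpos Gdiag R_def Rp_def X]
  have comb: "Rp *v (\<alpha> *\<^sub>R x1 - \<beta> *\<^sub>R x2) + R *v (transpose A *v (\<alpha> *\<^sub>R y1 - \<beta> *\<^sub>R y2))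
        = \<alpha> *\<^sub>R w1 - \<beta> *\<^sub>R w2"
      "Rp *v (\<alpha> *\<^sub>R x2 + \<beta> *\<^sub>R x1) + R *v (transpose A *v (\<alpha> *\<^sub>R y2 + \<beta> *\<^sub>R y1))
        = \<alpha> *\<^sub>R w2 + \<beta> *\<^sub>R w1"
    by (simp_all add: w1_def w2_def z1_def z2_def matrix_vector_right_distrib
        matrix_vector_mult_diff_distrib matrix_vector_mult_scaleR scaleR_add_right
        scaleR_diff_right del: transpose_matrix_vector)
  have z: "z1 = transpose (A ** R) *v y1" "z2 = transpose (A ** R) *v y2"
    using symmetric_matrix_diag_powr[of G "- 1/2"]
    by (simp_all add: z1_def z2_def R_def symmetric_matrix_def matrix_transpose_mul
        del: transpose_matrix_vector flip: matrix_vector_mul_assoc)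
  have real_eqs: "X *v w1 + E *v z1 = \<alpha> *\<^sub>R w1 - \<beta> *\<^sub>R w2"
      "X *v w2 + E *v z2 = \<alpha> *\<^sub>R w2 + \<beta> *\<^sub>R w1"
      "(A ** R) *v (K *v z1 - E *v w1) = S_upd *v (\<alpha> *\<^sub>R y1 - \<beta> *\<^sub>R y2)"
      "(A ** R) *v (K *v z2 - E *v w2) = S_upd *v (\<alpha> *\<^sub>R y2 + \<beta> *\<^sub>R y1)"
    using scaled[OF eqs(1,2)] scaled[OF eqs(3,4)]
    unfolding comb E_def[symmetric] K_def[symmetric] z1_def[symmetric] z2_def[symmetric]
      w1_def[symmetric] w2_def[symmetric] by blast+

  \<comment> \<open>Weights and Rayleigh quotients\<close>
  define a where "a = w1 \<bullet> w1 + w2 \<bullet> w2"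
  define b where "b = y1 \<bullet> (S_upd *v y1) + y2 \<bullet> (S_upd *v y2)"
  define c where "c = w1 \<bullet> (E *v z1) + w2 \<bullet> (E *v z2)"
  define d where "d = w1 \<bullet> (E *v z2) - w2 \<bullet> (E *v z1)"
  define p where "p = w1 \<bullet> (X *v w1) + w2 \<bullet> (X *v w2)"
  define q where "q = z1 \<bullet> (K *v z1) + z2 \<bullet> (K *v z2)"
  define g where "g = z1 \<bullet> z1 + z2 \<bullet> z2"
  note ids = saddle_real_identities[OF symX symE symK symT z real_eqs,
      folded a_def b_def c_def d_def p_def q_def]
  have T_nonneg: "0 \<le> v \<bullet> (S_upd *v v)" for v
    using Tpd by (cases "v = 0") (auto simp: pos_definite_def less_imp_le)
  have a0: "0 \<le> a" by (simp add: a_def)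
  have b0: "0 \<le> b" by (simp add: b_def T_nonneg)
  have g0: "0 \<le> g" by (simp add: g_def)
  have y0: "y = 0" if "b = 0"
  proof -
    have "y1 \<bullet> (S_upd *v y1) = 0" "y2 \<bullet> (S_upd *v y2) = 0"
      using that T_nonneg[of y1] T_nonneg[of y2] by (simp_all add: b_def)
    then have "y1 = 0" "y2 = 0" using Tpd by (metis less_irrefl pos_definite_def)+
    then show ?thesis by (simp add: y1_def y2_def flip: Re_vec_eq_Im_vec_eq_0_iff)
  qed
  \<comment> \<open>If both weights vanished, then \<open>y = 0\<close> and hence
    \<open>z = 0\<close>, so \<open>w = 0\<close> would read \<open>Rp x = 0\<close> and give
    \<open>x = 0\<close>, against the eigenvector being nonzero.\<close>
  have ab: "0 < a + b"
  proof (rule ccontr)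
    assume "\<not> 0 < a + b"
    then have "a = 0" "b = 0" using a0 b0 by linarith+
    then have w: "w1 = 0" "w2 = 0" and "y = 0"
      by (simp_all add: a_def y0 add_nonneg_eq_0_iff)
    then have "Rp *v x1 = 0" "Rp *v x2 = 0"
      by (simp_all add: w1_def w2_def z1_def z2_def y1_def y2_def Re_vec_def Im_vec_def flip: zero_vec_def)
    moreover have "R *v (Rp *v v) = v" for v
      by (simp add: matrix_vector_mul_assoc R_def Rp_def diag_powr_mult diag_powr_0[OF Gpos])
    ultimately have "x1 = 0" "x2 = 0" by (metis matrix_vector_mult_0_right)+
    then have "x = 0" by (simp add: x1_def x2_def flip: Re_vec_eq_Im_vec_eq_0_iff)
    then show False using assms(19) \<open>y = 0\<close> by (simp add: eigenvector_def)
  qed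
  have z_form: "z1 \<bullet> z1 = y1 \<bullet> (S *v y1)" "z2 \<bullet> z2 = y2 \<bullet> (S *v y2)"
  proof -
    \<comment> \<open>\<open>R\<close> is a symmetric square root of
      \<open>matrix_inv G\<close>.\<close>
    have "(R *v v) \<bullet> (R *v v) = v \<bullet> (matrix_inv G *v v)" for v
      using symmetric_matrix_dot[OF symmetric_matrix_diag_powr, of v G "- 1/2" "R *v v"]
      by (simp add: R_def matrix_vector_mul_assoc diag_powr_mult
          matrix_inv_diagonal[OF Gpos Gdiag])
    then show "z1 \<bullet> z1 = y1 \<bullet> (S *v y1)" "z2 \<bullet> z2 = y2 \<bullet> (S *v y2)"
      unfolding S_form z1_def z2_def by blast+
  qed
  have g_bounds: "slo * b \<le> g" "g \<le> shi * b" "g \<le> \<gamma>n * b"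
    using S_bounds[of y1] S_bounds[of y2] \<gamma>_bounds[of y1] \<gamma>_bounds[of y2]
    by (simp_all add: g_def z_form b_def distrib_left)
  have p_bounds: "lo * a \<le> p" "p \<le> hi * a"
    using X_bounds[of w1] X_bounds[of w2] by (simp_all add: p_def a_def distrib_left)
  have "(2 - hi) * g \<le> q" "q \<le> (2 - lo) * g"
    using X_bounds[of z1] X_bounds[of z2] unfolding q_def g_def K_form
    by (simp_all add: left_diff_distrib distrib_left)
  \<comment> \<open>Two comparisons are chained: \<open>q\<close> with \<open>g\<close> through
    \<open>2 I - X\<close>, and \<open>g\<close> with \<open>b\<close> through the spectrum of
    \<open>matrix_inv S_upd ** S\<close>. The products of their constants are \<open>lam_low\<close>
    and \<open>lam_up\<close>.\<close>
  moreover have "(2 - hi) * (slo * b) \<le> (2 - hi) * g" "(2 - lo) * g \<le> (2 - lo) * (shi * b)"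
    using g_bounds less_2 by (simp_all add: mult_left_mono)
  ultimately have q_bounds: "lam_low * b \<le> q" "q \<le> lam_up * b"
    unfolding up low by (simp_all add: algebra_simps)

  \<comment> \<open>Bounds on the real and imaginary parts of the eigenvalue\<close>
  have sum: "\<alpha> * (a + b) = p + q" using ids(1,2) by (simp add: distrib_left)
  note avg = weighted_average_bounds[OF a0 b0 ab sum p_bounds q_bounds]
  have nonreal: "a = b \<and> 0 < a" if "\<beta> \<noteq> 0"
    using ids(3,4) that ab by auto
  have complex_case: "1/2 * (lo + lam_low) \<le> \<alpha> \<and> \<alpha> \<le> 1/2 * (hi + lam_up)" if "\<beta> \<noteq> 0"
  proof -
    have ab': "a = b" "0 < a" using nonreal[OF that] by auto
    \<comment> \<open>With equal weights the average is the arithmetic mean, whence the factor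
      \<open>1/2\<close>.\<close>
    have "(lo + lam_low) * a \<le> (2 * \<alpha>) * a" "(2 * \<alpha>) * a \<le> (hi + lam_up) * a"
      using sum p_bounds q_bounds unfolding ab'(1)[symmetric] by (simp_all add: algebra_simps)
    then show ?thesis using ab'(2) by simp
  qed
  have y_zero_case: "lo \<le> \<alpha> \<and> \<alpha> \<le> hi" if "y = 0"
  proof -
    have "y1 = 0" "y2 = 0" using that by (simp_all add: y1_def y2_def Re_vec_def Im_vec_def vec_eq_iff)
    \<comment> \<open>Only the first quotient is left: \<open>\<alpha>\<close> is a Rayleigh
      quotient of \<open>X\<close>.\<close>
    then have "b = 0" "q = 0" by (simp_all add: b_def q_def z)
    then have "p = \<alpha> * a" "0 < a" using sum ab by simp_all
    then show ?thesis using p_bounds by simp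
  qed
  have \<gamma>n0: "0 \<le> \<gamma>n"
  proof -
    fix i :: 'n
    have "0 \<le> J $ i $ i / G $ i $ i" using Jpos[of i] Gpos[of i] by simp
    also have "\<dots> \<le> \<gamma>n" unfolding assms(14) by (intro Max_ge) auto
    finally show ?thesis .
  qed
  have im: "\<bar>\<beta>\<bar> \<le> sqrt \<gamma>n * matrix_norm2 E"
  proof (cases "\<beta> = 0")
    case True
    then show ?thesis using \<gamma>n0 matrix_norm2_nonneg[of E] by simp
  next
    case False
    then have ab': "a = b" "0 < a" using nonreal by auto
    have "\<bar>\<beta>\<bar> * a = \<bar>d\<bar>" using ids(3) a0 by (simp add: abs_mult)
    also have "\<dots> \<le> matrix_norm2 E * (sqrt a * sqrt g)"
      unfolding d_def a_def g_def by (rule norm_cross_bound)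
    \<comment> \<open>Equality of the weights turns \<open>g \<le> \<gamma>n * b\<close> into a
      bound by \<open>a\<close>, which then cancels.\<close>
    also have "\<dots> \<le> matrix_norm2 E * (sqrt a * sqrt (\<gamma>n * a))"
      using g_bounds(3) a0 matrix_norm2_nonneg[of E] by (simp add: ab' mult_left_mono)
    also have "\<dots> = sqrt \<gamma>n * matrix_norm2 E * a"
      using a0 by (simp add: real_sqrt_mult mult.left_commute)
    finally show ?thesis using ab'(2) by simp
  qed
  show ?thesis
    using complex_case y_zero_case avg \<gamma>_concl im
    by (simp add: \<alpha>_def \<beta>_def lo_def hi_def E_def)
qed

end
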